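(* Let $n,d,s,r\in\mathbb{N}$ with $d^s\mid n$ and $(r,d^s)_s=1$. Let $A=\{r+td^s : t=1,2,\ldots,n/d^s\}$. Then the number of elements $x\in A$ with $(x,n)_s=1$ is $\dfrac{\Phi_s(n)}{\Phi_s(d^s)}$.
   Context: $\mathbb{N}$ denotes the positive integers. For a positive integer $s$ and integers $a,b$ not both zero, $(a,b)_s$ denotes the largest $l^s$ with $l\in\mathbb{N}$ dividing both $a$ and $b$ (the generalized gcd; for $s=1$ it is the usual gcd); for several arguments $(a_1,\ldots,a_m)_s$ is the largest $l^s$ dividing all of them. Klee's function $\Phi_s(n)$, for $s,n\in\mathbb{N}$, is the number of integers $m$ with $1\le m\le n$ and $(m,n)_s=1$; equivalently $\Phi_s(n)=n\prod_{p \text{ prime},\,p^s\mid n}(1-p^{-s})$. *)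

theory Defs
  imports Complex_Main
begin

text \<open>
  The generalized gcd \<open>(a, b)\<^sub>s\<close>, restricted to natural arguments. It is meaningful for
  \<open>s > 0\<close> and \<open>a\<close>, \<open>b\<close> not both zero, where the set is finite and contains \<open>1\<close>.
\<close>
definition gen_gcd :: "nat \<Rightarrow> nat \<Rightarrow> nat \<Rightarrow> nat" where
  "gen_gcd s a b = Max {l ^ s | l. l > 0 \<and> l ^ s dvd a \<and> l ^ s dvd b}"

definition klee_phi :: "nat \<Rightarrow> nat \<Rightarrow> nat" where
  "klee_phi s n = card {m \<in> {1..n}. gen_gcd s m n = 1}"

end

theory Submission
  imports Defs "HOL-Number_Theory.Cong"
begin

text \<open>
  The condition \<open>(x, n)\<^sub>s = 1\<close> says that no prime \<open>p\<close> with \<open>p\<^sup>s | n\<close> satisfies \<open>p\<^sup>s | x\<close>, and it is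
  periodic in \<open>x\<close> with period \<open>n\<close>. Let \<open>q\<close> be the product of the \<open>p\<^sup>s\<close> over the primes \<open>p\<close> with
  \<open>p\<^sup>s | n\<close> and \<open>p\<close> not dividing \<open>d\<close>; it is coprime to \<open>d\<^sup>s\<close>. If \<open>u\<close> and \<open>v\<close> are residues modulo
  \<open>d\<^sup>s\<close> with \<open>(u, d\<^sup>s)\<^sub>s = (v, d\<^sup>s)\<^sub>s = 1\<close>, choose \<open>a\<close> divisible by \<open>q\<close> with \<open>a = v - u\<close> modulo \<open>d\<^sup>s\<close>.
  Translation by \<open>a\<close> carries the class of \<open>u\<close> to that of \<open>v\<close> and preserves the condition:
  primes dividing \<open>d\<close> are harmless in both classes, and for the others \<open>p\<^sup>s | a\<close>. Hence all these
  \<open>\<Phi>\<^sub>s(d\<^sup>s)\<close> classes contain equally many of the \<open>\<Phi>\<^sub>s(n)\<close> solutions in a period.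
\<close>

text \<open>Every \<open>l \<noteq> 1\<close> has a prime factor \<open>p\<close>, and
  \<open>p ^ s\<close> divides \<open>l ^ s\<close>, so prime bases suffice to detect a nontrivial
  common \<open>s\<close>-th power.\<close>

lemma gen_gcd_eq_1_iff:
  assumes "n > 0" and "s > 0"
  shows "gen_gcd s x n = 1 \<longleftrightarrow> (\<forall>p. prime p \<longrightarrow> p ^ s dvd n \<longrightarrow> \<not> p ^ s dvd x)"
proof -
  let ?S = "{l ^ s | l. l > 0 \<and> l ^ s dvd x \<and> l ^ s dvd n}"
  \<comment> \<open>Finiteness makes the \<open>Max\<close> in \<open>gen_gcd\<close> a genuine
    maximum.\<close>
  have "?S \<subseteq> {..n}"
    using assms by (auto dest: dvd_imp_le)
  then have fin: "finite ?S"
    by (rule finite_subset) simp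
  have one: "1 \<in> ?S"
    by (rule CollectI, rule exI[of _ 1]) simp
  show ?thesis
  proof
    assume max: "gen_gcd s x n = 1"
    show "\<forall>p. prime p \<longrightarrow> p ^ s dvd n \<longrightarrow> \<not> p ^ s dvd x"
    proof (intro allI impI notI)
      fix p :: nat
      assume p: "prime p" "p ^ s dvd n" "p ^ s dvd x"
      then have "p ^ s \<in> ?S"
        using prime_gt_0_nat by blast
      then have "p ^ s \<le> 1"
        using Max_ge[OF fin] max unfolding gen_gcd_def by fastforce
      moreover have "p ^ s > 1"
        using prime_gt_1_nat[OF p(1)] assms(2) by (rule one_less_power)
      ultimately show False by simp
    qed
  next
    assume *: "\<forall>p. prime p \<longrightarrow> p ^ s dvd n \<longrightarrow> \<not> p ^ s dvd x"
    have "l = 1" if l: "l ^ s dvd x" "l ^ s dvd n" for l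
    proof (rule ccontr)
      assume "l \<noteq> 1"
      then obtain p where "prime p" "p dvd l"
        using prime_factor_nat by blast
      then show False
        using * l dvd_trans[OF dvd_power_same[of p l s]] by blast
    qed
    then have "?S = {1}"
      using one by fastforce
    then show "gen_gcd s x n = 1"
      unfolding gen_gcd_def by simp
  qed
qed

lemma gen_gcd_cong:
  assumes "n > 0" and "s > 0" and "[x = y] (mod n)"
  shows "gen_gcd s x n = 1 \<longleftrightarrow> gen_gcd s y n = 1"
proof -
  have "p ^ s dvd x \<longleftrightarrow> p ^ s dvd y" if "p ^ s dvd n" for p
    using cong_dvd_iff[OF cong_dvd_modulus_nat[OF assms(3) that]] .
  then show ?thesis
    unfolding gen_gcd_eq_1_iff[OF assms(1,2)] by blast
qed

lemma gen_gcd_eq_1_dvd: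
  assumes "n > 0" and "s > 0" and "m dvd n" and "gen_gcd s x n = 1"
  shows "gen_gcd s x m = 1"
proof -
  have "m > 0"
    using assms(1,3) by (simp add: dvd_pos_nat)
  then show ?thesis
    using assms(4) gen_gcd_eq_1_iff[OF assms(1,2)] gen_gcd_eq_1_iff[OF _ assms(2), of m]
      dvd_trans[OF _ assms(3)] by blast
qed

text \<open>Moving the window one step to the right drops \<open>k\<close> and gains
  \<open>k + n\<close>, and \<open>P\<close> agrees on these two; \<open>M\<close> is the common
  part.\<close>

lemma card_period_shift:
  fixes n k :: nat
  assumes "\<And>x. P (x + n) \<longleftrightarrow> P x"
  shows "card {x \<in> {k..<k + n}. P x} = card {x \<in> {..<n}. P x}"
proof (induction k)
  case 0
  show ?case by (simp add: lessThan_atLeast0)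
next
  case (Suc k)
  show ?case
  proof (cases "n = 0")
    case False
    define M where "M = {x \<in> {Suc k..<k + n}. P x}"
    have "{x \<in> {k..<k + n}. P x} = (if P k then insert k M else M)"
      using False by (auto simp: M_def le_less Suc_le_eq)
    moreover have "{x \<in> {Suc k..<Suc k + n}. P x} = (if P k then insert (k + n) M else M)"
      using False assms[of k] by (auto simp: M_def less_Suc_eq)
    moreover have "finite M" "k \<notin> M" "k + n \<notin> M"
      by (auto simp: M_def)
    ultimately have "card {x \<in> {Suc k..<Suc k + n}. P x} = card {x \<in> {k..<k + n}. P x}"
      by (metis card_insert_disjoint)
    then show ?thesis
      using Suc.IH by simp
  qed simp
qed

lemma klee_phi_eq_card_lessThan:
  assumes "n > 0" and "s > 0"
  shows "klee_phi s n = card {x \<in> {..<n}. gen_gcd s x n = 1}"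
proof -
  have "gen_gcd s (x + n) n = 1 \<longleftrightarrow> gen_gcd s x n = 1" for x
    by (rule gen_gcd_cong[OF assms]) (simp add: cong_def)
  then have "card {x \<in> {1..<1 + n}. gen_gcd s x n = 1} = card {x \<in> {..<n}. gen_gcd s x n = 1}"
    by (rule card_period_shift)
  moreover have "{1..<1 + n} = {1..n}" by auto
  ultimately show ?thesis
    unfolding klee_phi_def by (simp only:)
qed

lemma card_class_eq:
  assumes "n > 0" and "d > 0" and "s > 0" and "d ^ s dvd n"
    and u: "gen_gcd s u (d ^ s) = 1" and v: "gen_gcd s v (d ^ s) = 1"
  shows "card {x \<in> {..<n}. gen_gcd s x n = 1 \<and> [x = u] (mod d ^ s)}
       = card {x \<in> {..<n}. gen_gcd s x n = 1 \<and> [x = v] (mod d ^ s)}"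
proof -
  define N where "N = d ^ s"
  have "N > 0" using assms(2) by (simp add: N_def)
  define Q where "Q = {p. prime p \<and> p ^ s dvd n \<and> \<not> p dvd d}"
  define q where "q = (\<Prod>p\<in>Q. p ^ s)"
  \<comment> \<open>This bound makes \<open>Q\<close> finite, so that each factor
    \<open>p ^ s\<close> really divides the product \<open>q\<close>.\<close>
  have "p \<le> n" if "p \<in> Q" for p
  proof -
    have "p dvd n"
      using that assms(3) dvd_trans[OF dvd_power] by (auto simp: Q_def)
    then show ?thesis using assms(1) by (rule dvd_imp_le)
  qed
  then have "finite Q"
    using finite_subset[of Q "{..n}"] by auto
  have "coprime q N"
    unfolding q_def N_def
    by (intro prod_coprime_left) (auto simp: Q_def intro: prime_imp_coprime)
  \<comment> \<open>The second residue is \<open>v - u\<close> modulo \<open>N\<close>, written so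
    that the subtraction on naturals does not truncate.\<close>
  then obtain a where a: "[a = 0] (mod q)" "[a = v + (N - u mod N)] (mod N)"
    using binary_chinese_remainder_nat by blast
  have "[u + a = u mod N + (v + (N - u mod N))] (mod N)"
    using a(2) by (intro cong_add) auto
  also have "u mod N + (v + (N - u mod N)) = v + N"
    using mod_less_divisor[OF \<open>N > 0\<close>, of u] by simp
  finally have uav: "[u + a = v] (mod N)"
    by (simp add: cong_def)
  have q: "p ^ s dvd a" if "p \<in> Q" for p
    using dvd_trans[OF dvd_prodI[OF \<open>finite Q\<close> that]] a(1)
    by (simp add: q_def cong_0_iff)
  have class_iff: "[x + a = v] (mod N) \<longleftrightarrow> [x = u] (mod N)" for x
    using uav cong_add_rcancel_nat cong_sym cong_trans by metis
  \<comment> \<open>For \<open>p\<close> dividing \<open>d\<close>, \<open>p ^ s\<close> divides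
    \<open>N\<close>, so the residue modulo \<open>N\<close> alone decides divisibility by
    \<open>p ^ s\<close>.\<close>
  have harmless: "\<not> p ^ s dvd y"
    if "prime p" "p dvd d" "[y = w] (mod N)" "gen_gcd s w N = 1" for p y w
  proof -
    have "p ^ s dvd N"
      using that(2) by (simp add: N_def dvd_power_same)
    then show ?thesis
      using that(1,4) gen_gcd_eq_1_iff[OF \<open>N > 0\<close> assms(3)]
        cong_dvd_iff[OF cong_dvd_modulus_nat[OF that(3)]] by blast
  qed
  have good_iff: "gen_gcd s (x + a) n = 1 \<longleftrightarrow> gen_gcd s x n = 1" if x: "[x = u] (mod N)" for x
  proof -
    have "p ^ s dvd x + a \<longleftrightarrow> p ^ s dvd x" if p: "prime p" "p ^ s dvd n" for p
    proof (cases "p dvd d")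
      case True
      then show ?thesis
        using harmless[OF p(1) True x] harmless[OF p(1) True, of "x + a" v] class_iff[of x] x u v
        by (simp add: N_def)
    next
      case False
      then have "p ^ s dvd a" using q p by (simp add: Q_def)
      then show ?thesis by (simp add: dvd_add_left_iff)
    qed
    then show ?thesis
      unfolding gen_gcd_eq_1_iff[OF assms(1,3)] by blast
  qed
  define P where "P y \<longleftrightarrow> gen_gcd s y n = 1 \<and> [y = v] (mod N)" for y
  have "[y + n = y] (mod N)" for y
    using assms(4) by (auto simp: N_def cong_def)
  then have per: "P (y + n) \<longleftrightarrow> P y" for y
    unfolding P_def using gen_gcd_cong[OF assms(1,3), of "y + n" y]
    by (metis cong_def cong_sym cong_trans mod_add_self2)
  \<comment> \<open>Translation by \<open>a\<close> moves the window to \<open>{a..<a + n}\<close>;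
    periodicity of \<open>P\<close> then brings it back to \<open>{..<n}\<close>.\<close>
  have "{x \<in> {..<n}. gen_gcd s x n = 1 \<and> [x = u] (mod N)} = {x \<in> {..<n}. P (x + a)}"
    using class_iff good_iff by (auto simp: P_def)
  also have "card \<dots> = card {y \<in> {a..<a + n}. P y}"
    by (rule bij_betw_same_card[of "\<lambda>x. x + a"], rule bij_betw_byWitness[where f' = "\<lambda>y. y - a"]) auto
  also have "\<dots> = card {y \<in> {..<n}. P y}"
    by (rule card_period_shift) (rule per)
  finally show ?thesis by (simp add: P_def N_def)
qed

theorem theorem3p1:
  fixes n d s r :: nat and A :: "nat set"
  assumes "n > 0" and "d > 0" and "s > 0" and "r > 0"
    and "d ^ s dvd n"
    and "gen_gcd s r (d ^ s) = 1"
    and "A = {r + t * d ^ s | t. t \<in> {1..n div d ^ s}}"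
  shows "real (card {x \<in> A. gen_gcd s x n = 1}) = real (klee_phi s n) / real (klee_phi s (d ^ s))"
proof -
  define N where "N = d ^ s"
  have "N > 0" using assms(2) by (simp add: N_def)
  have "N dvd n" using assms(5) by (simp add: N_def)
  then obtain k where k: "n = k * N" by (metis dvd_def mult.commute)
  define C where "C u = {x \<in> {..<n}. gen_gcd s x n = 1 \<and> [x = u] (mod N)}" for u
  define R where "R = {u \<in> {..<N}. gen_gcd s u N = 1}"
  \<comment> \<open>Since \<open>t\<close> runs from 1 to \<open>n div N\<close>, the set
    \<open>A\<close> is the class of \<open>r\<close> within one full period, starting just after
    \<open>r\<close>.\<close>
  have A_eq: "A = {x \<in> {Suc r..<Suc r + n}. [x = r] (mod N)}"
  proof (intro set_eqI iffI)
    fix x assume "x \<in> A"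
    then obtain t where t: "x = r + t * N" "1 \<le> t" "t \<le> k"
      using assms(7) \<open>N > 0\<close> k by (auto simp: N_def)
    have "t * N \<le> n" "0 < t * N"
      using t \<open>N > 0\<close> k by auto
    with t(1) show "x \<in> {x \<in> {Suc r..<Suc r + n}. [x = r] (mod N)}"
      by (auto simp: cong_def)
  next
    fix x assume x: "x \<in> {x \<in> {Suc r..<Suc r + n}. [x = r] (mod N)}"
    then have "N dvd x - r"
      by (auto simp: cong_altdef_nat)
    then obtain t where t: "x - r = t * N" by (metis dvd_def mult.commute)
    moreover have "0 < x - r" "x - r \<le> k * N" and "x = r + (x - r)"
      using x k by auto
    ultimately have "t * N \<le> k * N" "0 < t * N" and xt: "x = r + t * N"
      by simp_all
    then have "t \<in> {1..n div d ^ s}"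
      using \<open>N > 0\<close> k by (auto simp flip: N_def)
    with xt show "x \<in> A"
      using assms(7) by (auto simp: N_def)
  qed
  have "[y + n = y] (mod N)" for y
    using k by (simp add: cong_def)
  then have per: "gen_gcd s (y + n) n = 1 \<and> [y + n = r] (mod N) \<longleftrightarrow>
      gen_gcd s y n = 1 \<and> [y = r] (mod N)" for y
    using gen_gcd_cong[OF assms(1,3), of "y + n" y]
    by (metis cong_def cong_sym cong_trans mod_add_self2)
  have "{x \<in> A. gen_gcd s x n = 1} =
      {x \<in> {Suc r..<Suc r + n}. gen_gcd s x n = 1 \<and> [x = r] (mod N)}"
    unfolding A_eq by blast
  then have card_A: "card {x \<in> A. gen_gcd s x n = 1} = card (C r)"
    unfolding C_def using card_period_shift[where k = "Suc r" and
        P = "\<lambda>x. gen_gcd s x n = 1 \<and> [x = r] (mod N)", OF per] by (simp only:)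
  have "card (C u) = card (C r)" if "u \<in> R" for u
    unfolding C_def N_def
    using that card_class_eq[OF assms(1,2,3,5) _ assms(6)] by (simp add: R_def N_def)
  \<comment> \<open>As \<open>N\<close> divides \<open>n\<close>, a solution for \<open>n\<close> is
    also one for \<open>N\<close>, so its residue lies in \<open>R\<close>; the classes
    \<open>C u\<close> thus partition the solutions.\<close>
  moreover have "{x \<in> {..<n}. gen_gcd s x n = 1} = (\<Union>u\<in>R. C u)"
  proof (intro set_eqI iffI)
    fix x assume x: "x \<in> {x \<in> {..<n}. gen_gcd s x n = 1}"
    then have "gen_gcd s x N = 1"
      using gen_gcd_eq_1_dvd[OF assms(1,3) \<open>N dvd n\<close>] by simp
    then have "x mod N \<in> R"
      using gen_gcd_cong[OF \<open>N > 0\<close> assms(3), of "x mod N" x] \<open>N > 0\<close>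
      by (simp add: R_def)
    moreover have "x \<in> C (x mod N)"
      using x by (simp add: C_def)
    ultimately show "x \<in> (\<Union>u\<in>R. C u)" by blast
  qed (auto simp: C_def)
  moreover have "card (\<Union>u\<in>R. C u) = (\<Sum>u\<in>R. card (C u))"
    by (rule card_UN_disjoint) (auto simp: R_def C_def cong_def)
  ultimately have "klee_phi s n = card R * card (C r)"
    using klee_phi_eq_card_lessThan[OF assms(1,3)] by simp
  moreover have "klee_phi s N = card R"
    unfolding R_def by (rule klee_phi_eq_card_lessThan[OF \<open>N > 0\<close> assms(3)])
  \<comment> \<open>The residue of \<open>r\<close> is a member of \<open>R\<close>, so the final
    division is not by zero.\<close>
  moreover have "card R > 0"
  proof -
    have "r mod N \<in> R"
      using assms(6) gen_gcd_cong[OF \<open>N > 0\<close> assms(3), of "r mod N" r] \<open>N > 0\<close>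
      by (simp add: R_def N_def)
    moreover have "finite R" by (simp add: R_def)
    ultimately show ?thesis by (auto simp: card_gt_0_iff)
  qed
  ultimately show ?thesis
    using card_A by (simp add: N_def)
qed

end
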